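(* Let $\lambda_p,p_p,p_g>0$, $\alpha>2$, $\eta=p_p/p_g$, and let $\Phi_p$ be a homogeneous Poisson point process on $\mathbb{R}^2$ of intensity $\lambda_p$. Conditionally on $R>0$ (resp. on $U\in\mathbb{R}^2$), the Laplace transforms at $\xi>0$ of the interference from $\Phi_p^{!\sim R}$ and from $\Phi_p^{!\sim\|U\|\eta^{1/\alpha}}$ are $$\mathcal{L}_{I_{\Phi_p^{!\sim R}}}(\xi)=\exp\Big(-2\pi\lambda_p\int_R^\infty\frac{p_p\xi u^{1-\alpha}}{1+p_p\xi u^{-\alpha}}\,du\Big),$$ $$\mathcal{L}_{I_{\Phi_p^{!\sim\|U\|\eta^{1/\alpha}}}}(\xi)=\exp\Big(-2\pi\lambda_p\int_{\|U\|\eta^{1/\alpha}}^\infty\frac{p_p\xi u^{1-\alpha}}{1+p_p\xi u^{-\alpha}}\,du\Big).$$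
   Context: For $r>0$, $\Phi_p^{!\sim r}$ denotes the point process $\Phi_p$ conditioned on having no points in the ball of radius $r$ centered at the origin. The interference from a point process $\Psi$ of Poisson base stations is $I_\Psi=\sum_{X\in\Psi}p_pH_X\|X\|^{-\alpha}$, where the $H_X$ are i.i.d. exponential with mean one, independent of the points. $\mathcal{L}_{I}(\xi)=\mathbf{E}[e^{-\xi I}]$, here computed for given (fixed) values of $R$ and $U$; $R$ is the distance from the user at the origin to its serving Poisson base station, and $U$ is the location of its serving grid base station. *)

theory Defs
  imports "HOL-Probability.Probability"
begin

section \<open>Point processes as random locally finite sets\<close>

text \<open>
  All processes below are simple, so a configuration is identified with its set of points. The
  sigma-algebra on configurations is the usual one, generated by the counts in bounded Borel sets.
\<close>

definition locally_finite :: "'a::euclidean_space set \<Rightarrow> bool" where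
  "locally_finite A \<longleftrightarrow> (\<forall>B. bounded B \<longrightarrow> finite (A \<inter> B))"

definition config_space :: "'a::euclidean_space set measure" where
  "config_space = sigma {A. locally_finite A}
     {{A. locally_finite A \<and> card (A \<inter> B) = n} | B n. B \<in> sets borel \<and> bounded B}"

definition point_process :: "'w measure \<Rightarrow> ('w \<Rightarrow> 'a::euclidean_space set) \<Rightarrow> bool" where
  "point_process M \<Phi> \<longleftrightarrow> prob_space M \<and> \<Phi> \<in> measurable M config_space"

text \<open>
  The Poisson weights are written out because \<^const>\<open>poisson_pmf\<close> is only specified for a
  positive rate, whereas Lebesgue-null sets require rate zero.
\<close>

definition homogeneous_poisson_process ::
  "real \<Rightarrow> 'w measure \<Rightarrow> ('w \<Rightarrow> 'a::euclidean_space set) \<Rightarrow> bool" where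
  "homogeneous_poisson_process lam M \<Phi> \<longleftrightarrow>
     point_process M \<Phi> \<and>
     (\<forall>B n. B \<in> sets borel \<longrightarrow> bounded B \<longrightarrow>
        measure M {\<omega> \<in> space M. card (\<Phi> \<omega> \<inter> B) = n} =
          (lam * measure lborel B) ^ n / fact n * exp (- (lam * measure lborel B))) \<and>
     (\<forall>\<B>. finite \<B> \<longrightarrow> disjoint \<B> \<longrightarrow> (\<forall>B\<in>\<B>. B \<in> sets borel \<and> bounded B) \<longrightarrow>
        prob_space.indep_vars M (\<lambda>_. count_space UNIV) (\<lambda>B \<omega>. card (\<Phi> \<omega> \<inter> B)) \<B>)"

text \<open>
  \<open>\<Psi>\<close>, possibly living on another probability space, has the law of \<open>\<Phi>\<close> conditioned on having no
  points in the ball of radius \<open>r\<close> centered at the origin. For \<open>r = 0\<close> the ball is empty and the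
  conditioning is void.
\<close>

definition conditioned_outside_ball ::
  "'w measure \<Rightarrow> ('w \<Rightarrow> 'a::euclidean_space set) \<Rightarrow> real \<Rightarrow>
   'v measure \<Rightarrow> ('v \<Rightarrow> 'a set) \<Rightarrow> bool" where
  "conditioned_outside_ball M \<Phi> r N \<Psi> \<longleftrightarrow>
     point_process N \<Psi> \<and>
     distr N config_space \<Psi> =
       uniform_measure (distr M config_space \<Phi>) {A \<in> space config_space. A \<inter> ball 0 r = {}}"


section \<open>Interference\<close>

text \<open>
  \<open>H \<omega> x\<close> is the mark of the point \<open>x \<in> \<Psi> \<omega>\<close>. Independence of marks that are attached to random
  points is expressed through a measurable enumeration \<open>X\<close> of the points: the marks listed along
  \<open>X\<close> are i.i.d. exponential and independent of the points together with their enumeration. If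
  \<open>\<Psi> \<omega>\<close> has only \<open>k\<close> points, just \<open>X 0 \<omega>, \<dots>, X (k - 1) \<omega>\<close> are used.
\<close>

definition iid_exponential_marks ::
  "'w measure \<Rightarrow> ('w \<Rightarrow> 'a::euclidean_space set) \<Rightarrow> ('w \<Rightarrow> 'a \<Rightarrow> real) \<Rightarrow> bool" where
  "iid_exponential_marks N \<Psi> H \<longleftrightarrow>
     point_process N \<Psi> \<and>
     (\<exists>(X :: nat \<Rightarrow> 'w \<Rightarrow> 'a) (E :: nat \<Rightarrow> 'w \<Rightarrow> real).
        (\<forall>n. X n \<in> borel_measurable N) \<and>
        (\<forall>\<omega>\<in>space N. bij_betw (\<lambda>n. X n \<omega>) {n. finite (\<Psi> \<omega>) \<longrightarrow> n < card (\<Psi> \<omega>)} (\<Psi> \<omega>)) \<and>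
        (\<forall>\<omega>\<in>space N. \<forall>n. (finite (\<Psi> \<omega>) \<longrightarrow> n < card (\<Psi> \<omega>)) \<longrightarrow> H \<omega> (X n \<omega>) = E n \<omega>) \<and>
        (\<forall>n. distributed N lborel (E n) (exponential_density 1)) \<and>
        prob_space.indep_vars N (\<lambda>_. borel) E UNIV \<and>
        prob_space.indep_set N
          (sets (vimage_algebra (space N) (\<lambda>\<omega>. (\<Psi> \<omega>, \<lambda>n. X n \<omega>))
             (config_space \<Otimes>\<^sub>M (\<Pi>\<^sub>M n\<in>UNIV. borel))))
          (sets (vimage_algebra (space N) (\<lambda>\<omega> n. E n \<omega>) (\<Pi>\<^sub>M n\<in>UNIV. borel))))"

text \<open>
  The sum is taken in \<^typ>\<open>ennreal\<close>, so it is meaningful whether or not it converges. A point at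
  the origin contributes \<open>0\<close> because \<open>0 powr (-\<alpha>) = 0\<close>; the Poisson processes considered have
  almost surely no such point.
\<close>

definition interference ::
  "real \<Rightarrow> real \<Rightarrow> ('w \<Rightarrow> 'a::euclidean_space set) \<Rightarrow> ('w \<Rightarrow> 'a \<Rightarrow> real) \<Rightarrow> 'w \<Rightarrow> ennreal" where
  "interference p \<alpha> \<Psi> H \<omega> = (\<Sum>\<^sub>\<infinity>x\<in>\<Psi> \<omega>. ennreal (p * H \<omega> x * norm x powr (-\<alpha>)))"

text \<open>Laplace transform of a \<open>[0, \<infinity>]\<close>-valued random variable, with \<open>e\<close> to the \<open>-\<infinity>\<close> equal to \<open>0\<close>.\<close>

definition laplace_transform :: "'w measure \<Rightarrow> ('w \<Rightarrow> ennreal) \<Rightarrow> real \<Rightarrow> real" where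
  "laplace_transform N I \<xi> =
     (\<integral>\<omega>. (if I \<omega> = \<infinity> then 0 else exp (- \<xi> * enn2real (I \<omega>))) \<partial>N)"

end

theory Submission
  imports Defs
begin

text \<open>
  Integrating out the independent exponential marks turns each factor \<open>e\<close> to the \<open>-w(x) H\<^sub>x\<close> into
  \<open>1 / (1 + w(x))\<close>, with \<open>w(x) = p \<xi> \<parallel>x\<parallel>\<close> to the \<open>-\<alpha>\<close>. What is left is the Laplace functional of the
  conditioned process at \<open>f = ln (1 + w)\<close>. Conditioning on an empty ball amounts to setting \<open>f = \<infinity>\<close>
  there and dividing by the void probability, so the Poisson Laplace functional
  \<open>exp (- lam \<integral> (1 - exp (- f)))\<close> loses exactly the contribution of the ball. Integration in polar
  coordinates gives the claim.
\<close>

section \<open>The exponential of a negative extended real\<close>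

definition exp_neg :: "ennreal \<Rightarrow> ennreal" where
  "exp_neg x = (if x = \<infinity> then 0 else ennreal (exp (- enn2real x)))"

lemma exp_neg_ennreal [simp]: "r \<ge> 0 \<Longrightarrow> exp_neg (ennreal r) = ennreal (exp (- r))"
  by (simp add: exp_neg_def)

lemma exp_neg_top [simp]: "exp_neg top = 0"
  by (simp add: exp_neg_def)

lemma exp_neg_zero [simp]: "exp_neg 0 = 1"
  by (simp add: exp_neg_def)

lemma exp_neg_le_1: "exp_neg x \<le> 1"
  by (cases x) (auto simp flip: ennreal_1 intro!: ennreal_leI)

lemma exp_neg_add: "exp_neg (x + y) = exp_neg x * exp_neg y"
  by (cases x; cases y) (auto simp flip: ennreal_plus ennreal_mult simp: exp_add[symmetric])

lemma exp_neg_neq_top [simp]: "exp_neg x \<noteq> top"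
  by (simp add: exp_neg_def)

lemma exp_neg_eq_0_iff [simp]: "exp_neg x = 0 \<longleftrightarrow> x = top"
  by (simp add: exp_neg_def)

lemma exp_neg_antimono: "x \<le> y \<Longrightarrow> exp_neg y \<le> exp_neg x"
  by (cases x; cases y) (auto simp: top_unique intro!: ennreal_leI)

lemma exp_neg_sum: "exp_neg (sum f A) = (\<Prod>a\<in>A. exp_neg (f a))"
  by (induction A rule: infinite_finite_induct) (auto simp: exp_neg_add)

lemma borel_measurable_exp_neg [measurable]: "exp_neg \<in> borel_measurable borel"
  unfolding exp_neg_def by measurable

lemma tendsto_exp_neg:
  assumes "(f \<longlongrightarrow> l) F"
  shows "((\<lambda>x. exp_neg (f x)) \<longlongrightarrow> exp_neg l) F"
proof (cases l)
  case (real r)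
  have "eventually (\<lambda>x. f x < top) F"
    using assms real by (auto intro: order_tendstoD)
  then have "eventually (\<lambda>x. ennreal (exp (- enn2real (f x))) = exp_neg (f x)) F"
    by eventually_elim (auto simp: exp_neg_def)
  moreover have "((\<lambda>x. ennreal (exp (- enn2real (f x)))) \<longlongrightarrow> ennreal (exp (- r))) F"
    using assms real by (intro tendsto_intros) auto
  ultimately show ?thesis
    using real by (auto intro: Lim_transform_eventually)
next
  case top
  show ?thesis
    unfolding top exp_neg_top
  proof (rule order_tendstoI)
    fix a :: ennreal assume "0 < a"
    then obtain e where e: "e > 0" "ennreal e < a"
      by (metis dense ennreal_cases ennreal_less_zero_iff leD top_greatest)
    obtain k where k: "k \<ge> 0" "k \<ge> - ln e"
      by (meson linear order_refl)
    have "eventually (\<lambda>x. ennreal k < f x) F"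
      using assms top by (auto intro: order_tendstoD)
    then show "eventually (\<lambda>x. exp_neg (f x) < a) F"
    proof eventually_elim
      case (elim x)
      show ?case
      proof (cases "f x")
        case (real s)
        then have "k < s"
          using elim k by (simp add: ennreal_less_iff)
        then have "exp (- s) \<le> exp (ln e)"
          using k by (subst exp_le_cancel_iff) auto
        then have "exp_neg (f x) \<le> ennreal e"
          using real e by (auto intro: ennreal_leI)
        then show ?thesis
          using e by auto
      qed (use \<open>0 < a\<close> in auto)
    qed
  qed auto
qed

lemma laplace_transform_eq_nn_integral:
  assumes "I \<in> borel_measurable N" "\<xi> > 0"
  shows "laplace_transform N I \<xi> = enn2real (\<integral>\<^sup>+\<omega>. exp_neg (ennreal \<xi> * I \<omega>) \<partial>N)"
proof -
  have eq: "exp_neg (ennreal \<xi> * I \<omega>) =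
      ennreal (if I \<omega> = \<infinity> then 0 else exp (- \<xi> * enn2real (I \<omega>)))" for \<omega>
    using assms(2) by (cases "I \<omega>") (auto simp: ennreal_mult_top simp flip: ennreal_mult)
  show ?thesis
    unfolding laplace_transform_def eq using assms(1)
    by (intro integral_eq_nn_integral) auto
qed

lemma nn_integral_exp_neg_LIMSEQ:
  assumes "prob_space M" "\<And>n. f n \<in> borel_measurable M"
    "\<And>\<omega>. \<omega> \<in> space M \<Longrightarrow> (\<lambda>n. f n \<omega>) \<longlonglongrightarrow> g \<omega>"
  shows "(\<lambda>n. \<integral>\<^sup>+\<omega>. exp_neg (f n \<omega>) \<partial>M) \<longlonglongrightarrow> (\<integral>\<^sup>+\<omega>. exp_neg (g \<omega>) \<partial>M)"
proof -
  interpret prob_space M by fact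
  note [measurable] = assms(2)
  have [measurable]: "g \<in> borel_measurable M"
    by (rule borel_measurable_LIMSEQ_order[OF assms(3) assms(2)])
  show ?thesis
    by (rule nn_integral_dominated_convergence[where w = "\<lambda>_. 1"])
       (auto simp: exp_neg_le_1 emeasure_space_1 intro!: tendsto_exp_neg assms(3))
qed

lemma infsum_cmult_ennreal:
  fixes f :: "'a \<Rightarrow> ennreal"
  shows "c * infsum f A = infsum (\<lambda>x. c * f x) A"
  by (simp add: nonneg_infsum_complete SUP_mult_left_ennreal sum_distrib_left)

lemma infsum_nat_ennreal:
  fixes f :: "nat \<Rightarrow> ennreal"
  shows "infsum f UNIV = suminf f"
proof -
  have "(f has_sum (SUP F\<in>{F. finite F \<and> F \<subseteq> UNIV}. sum f F)) UNIV"
    by (rule nonneg_has_sum_complete) simp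
  from has_sum_imp_sums[OF this] infsumI[OF this] show ?thesis
    by (simp add: sums_iff)
qed

lemma infsum_enumeration:
  fixes g :: "'a \<Rightarrow> ennreal"
  assumes "bij_betw X {n::nat. P n} A"
  shows "infsum g A = (\<Sum>n. if P n then g (X n) else 0)"
proof -
  have "infsum g A = infsum (\<lambda>n. g (X n)) {n. P n}"
    by (rule infsum_reindex_bij_betw[symmetric, OF assms])
  also have "\<dots> = infsum (\<lambda>n. if P n then g (X n) else 0) UNIV"
    by (rule infsum_cong_neutral) auto
  finally show ?thesis
    by (simp add: infsum_nat_ennreal)
qed

lemma nn_integral_count_space_enumeration:
  fixes g :: "'a \<Rightarrow> ennreal"
  assumes "bij_betw X {n::nat. P n} A"
  shows "(\<integral>\<^sup>+x. g x \<partial>count_space A) = (\<Sum>n. if P n then g (X n) else 0)"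
proof -
  have "(\<integral>\<^sup>+x. g x \<partial>count_space A) = (\<integral>\<^sup>+n. g (X n) \<partial>count_space {n. P n})"
    by (rule nn_integral_bij_count_space[symmetric, OF assms])
  also have "\<dots> = (\<integral>\<^sup>+n. g (X n) * indicator {n. P n} n \<partial>count_space UNIV)"
    by (simp add: nn_integral_count_space_indicator)
  also have "\<dots> = (\<Sum>n. g (X n) * indicator {n. P n} n)"
    by (rule nn_integral_count_space_nat)
  also have "(\<lambda>n. g (X n) * indicator {n. P n} n) = (\<lambda>n. if P n then g (X n) else 0)"
    by auto
  finally show ?thesis .
qed

section \<open>Measurable functionals of configurations\<close>

lemma measurable_config_count [measurable]:
  assumes "B \<in> sets borel" "bounded B"
  shows "(\<lambda>A. card (A \<inter> B)) \<in> measurable (config_space :: 'a::euclidean_space set measure) (count_space UNIV)"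
proof (rule measurable_count_space_eq2_countable[THEN iffD2], safe)
  fix n
  have "{A. locally_finite A \<and> card (A \<inter> B) = n} \<in> sets config_space"
    unfolding config_space_def using assms by (intro in_measure_of) auto
  then show "(\<lambda>A. card (A \<inter> B)) -` {n} \<inter> space config_space \<in> sets config_space"
    by (rule back_subst[where P = "\<lambda>A. A \<in> sets config_space"])
       (auto simp: config_space_def space_measure_of_conv)
qed auto

lemma space_config_space: "space config_space = {A. locally_finite A}"
  by (simp add: config_space_def space_measure_of_conv)

lemma measurable_config_has_nth [measurable]:
  "Measurable.pred (config_space :: 'a::euclidean_space set measure) (\<lambda>A. finite A \<longrightarrow> n < card A)"
proof -
  have eq: "(finite A \<longrightarrow> n < card A) \<longleftrightarrow> (\<exists>m::nat. n < card (A \<inter> cball 0 (real m)))"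
    if "A \<in> space config_space" for A :: "'a set"
  proof (rule iffI)
    assume "\<exists>m::nat. n < card (A \<inter> cball 0 (real m))"
    then show "finite A \<longrightarrow> n < card A"
      by (meson card_mono inf_le1 less_le_trans)
  next
    assume *: "finite A \<longrightarrow> n < card A"
    obtain B where B: "B \<subseteq> A" "finite B" "card B = Suc n"
    proof (cases "finite A")
      case True
      with * have "Suc n \<le> card A" by auto
      then show ?thesis
        using that True by (metis obtain_subset_with_card_n)
    next
      case False
      then show ?thesis
        using that by (metis infinite_arbitrarily_large)
    qed
    have "bounded B"
      using B by (simp add: finite_imp_bounded)
    then obtain r where r: "\<forall>x\<in>B. norm x \<le> r"
      by (auto simp: bounded_iff)
    obtain m :: nat where "r \<le> real m"
      using real_arch_simple by blast
    then have "B \<subseteq> A \<inter> cball 0 (real m)"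
      using r B by fastforce
    moreover have "finite (A \<inter> cball 0 (real m))"
      using that by (auto simp: space_config_space locally_finite_def)
    ultimately show "\<exists>m::nat. n < card (A \<inter> cball 0 (real m))"
      using B by (metis card_mono Suc_le_lessD)
  qed
  have [measurable]: "(\<lambda>A. card (A \<inter> cball 0 (real m))) \<in>
      measurable (config_space :: 'a set measure) (count_space UNIV)" for m
    by (intro measurable_config_count) auto
  have "Measurable.pred (config_space :: 'a set measure) (\<lambda>A. \<exists>m::nat. n < card (A \<inter> cball 0 (real m)))"
    by measurable
  then show ?thesis
    by (subst measurable_cong[OF eq])
qed

lemma bounded_simple_approximation:
  fixes f :: "'a::euclidean_space \<Rightarrow> ennreal"
  assumes "f \<in> borel_measurable borel"
  obtains g :: "nat \<Rightarrow> 'a \<Rightarrow> ennreal" where "incseq g" "\<And>i x. g i x < top"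
    "\<And>i. simple_function borel (g i)" "\<And>i. bounded {x. g i x \<noteq> 0}" "\<And>x. (SUP i. g i x) = f x"
proof -
  obtain F where F: "\<And>i. simple_function borel (F i)" "incseq F" "\<And>i x. F i x < top"
      "\<And>x. (SUP i. F i x) = f x"
    using borel_measurable_implies_simple_function_sequence'[OF assms] by blast
  define g where "g i x = F i x * indicator (cball 0 (real i)) x" for i x
  have "incseq g"
    using F(2) by (auto simp: incseq_def le_fun_def g_def intro!: mult_mono split: split_indicator)
  moreover have "g i x < top" for i x
    using F(3) by (auto simp: g_def split: split_indicator)
  moreover have "simple_function borel (g i)" for i
    unfolding g_def by (intro simple_function_mult F simple_function_indicator) auto
  moreover have "bounded {x. g i x \<noteq> 0}" for i
    by (rule bounded_subset[OF bounded_cball[of 0 "real i"]]) (auto simp: g_def split: split_indicator_asm)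
  moreover have "(SUP i. g i x) = f x" for x
  proof (rule LIMSEQ_unique)
    show "(\<lambda>i. g i x) \<longlonglongrightarrow> (SUP i. g i x)"
      using \<open>incseq g\<close> by (intro LIMSEQ_SUP) (auto simp: incseq_def le_fun_def)
    have "(\<lambda>i. F i x) \<longlonglongrightarrow> f x"
      unfolding F(4)[symmetric] using F(2) by (intro LIMSEQ_SUP) (auto simp: incseq_def le_fun_def)
    moreover have "eventually (\<lambda>i. F i x = g i x) sequentially"
      using eventually_ge_at_top[of "nat \<lceil>norm x\<rceil>"]
      by eventually_elim (auto simp: g_def nat_le_iff ceiling_le_iff)
    ultimately show "(\<lambda>i. g i x) \<longlonglongrightarrow> f x"
      by (rule Lim_transform_eventually)
  qed
  ultimately show ?thesis
    using that by blast
qed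

lemma nn_integral_count_space_simple:
  fixes g :: "'a::euclidean_space \<Rightarrow> ennreal"
  assumes fin: "finite (range g)" and bdd: "bounded {x. g x \<noteq> 0}" and A: "locally_finite A"
  shows "(\<integral>\<^sup>+x. g x \<partial>count_space A) = (\<Sum>c\<in>range g - {0}. c * of_nat (card (A \<inter> g -` {c})))"
proof -
  have fin_A: "finite (A \<inter> g -` {c})" if "c \<noteq> 0" for c
  proof -
    have "bounded (g -` {c})"
      using that by (intro bounded_subset[OF bdd]) auto
    then show ?thesis
      using A by (auto simp: locally_finite_def)
  qed
  have "(\<integral>\<^sup>+x. g x \<partial>count_space A) =
      (\<integral>\<^sup>+x. (\<Sum>c\<in>range g - {0}. c * indicator (A \<inter> g -` {c}) x) \<partial>count_space A)"
  proof (intro nn_integral_cong)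
    fix x assume "x \<in> space (count_space A)"
    then have "(\<Sum>c\<in>range g - {0}. c * indicator (A \<inter> g -` {c}) x) =
        (\<Sum>c\<in>range g - {0}. if c = g x then c else 0)"
      by (intro sum.cong) auto
    also have "\<dots> = g x"
      using fin by (subst sum.delta) auto
    finally show "g x = (\<Sum>c\<in>range g - {0}. c * indicator (A \<inter> g -` {c}) x)" ..
  qed
  also have "\<dots> = (\<Sum>c\<in>range g - {0}. \<integral>\<^sup>+x. c * indicator (A \<inter> g -` {c}) x \<partial>count_space A)"
    by (rule nn_integral_sum) auto
  also have "\<dots> = (\<Sum>c\<in>range g - {0}. c * of_nat (card (A \<inter> g -` {c})))"
    by (intro sum.cong refl, subst nn_integral_cmult_indicator)
       (auto simp: emeasure_count_space_finite fin_A)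
  finally show ?thesis .
qed

lemma borel_measurable_count_space_sum [measurable]:
  fixes f :: "'a::euclidean_space \<Rightarrow> ennreal"
  assumes "f \<in> borel_measurable borel"
  shows "(\<lambda>A. \<integral>\<^sup>+x. f x \<partial>count_space A) \<in> borel_measurable config_space"
proof -
  obtain g where g: "incseq g" "\<And>i x. g i x < top" "\<And>i. simple_function borel (g i)"
      "\<And>i. bounded {x. g i x \<noteq> 0}" "\<And>x. (SUP i. g i x) = f x"
    using bounded_simple_approximation[OF assms] by metis
  have [measurable]: "(\<lambda>A. \<integral>\<^sup>+x. g i x \<partial>count_space A) \<in> borel_measurable config_space" for i
  proof -
    have fin: "finite (range (g i))"
      using g(3)[of i] by (simp add: simple_function_def)
    have [measurable]: "(\<lambda>A. card (A \<inter> g i -` {c})) \<in> measurable config_space (count_space UNIV)"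
      if "c \<in> range (g i) - {0}" for c
    proof (rule measurable_config_count)
      show "g i -` {c} \<in> sets borel"
        using borel_measurable_simple_function[OF g(3)[of i]] measurable_sets_borel[of "g i" borel] by simp
      show "bounded (g i -` {c})"
        using that by (intro bounded_subset[OF g(4)[of i]]) auto
    qed
    have "(\<lambda>A. \<Sum>c\<in>range (g i) - {0}. c * of_nat (card (A \<inter> g i -` {c}))) \<in> borel_measurable config_space"
      by measurable
    then show ?thesis
      by (subst measurable_cong[OF nn_integral_count_space_simple[OF fin g(4)]])
         (auto simp: space_config_space)
  qed
  have "(\<integral>\<^sup>+x. f x \<partial>count_space A) = (SUP i. \<integral>\<^sup>+x. g i x \<partial>count_space A)" for A
    unfolding g(5)[symmetric] using g(1) by (intro nn_integral_monotone_convergence_SUP) auto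
  then show ?thesis
    by simp
qed

section \<open>Integrating out the marks\<close>

lemma exponential_exp_neg:
  assumes E: "distributed M lborel E (exponential_density 1)" and c: "c \<ge> 0"
  shows "(\<integral>\<^sup>+\<omega>. exp_neg (ennreal (c * E \<omega>)) \<partial>M) = exp_neg (ennreal (ln (1 + c)))"
proof -
  interpret D: prob_space "density lborel (exponential_density (1 + c))"
    using c by (intro prob_space_exponential_density) auto
  have 1: "(\<integral>\<^sup>+x. ennreal (exponential_density (1 + c) x) \<partial>lborel) = 1"
    using D.emeasure_space_1 by (simp add: emeasure_density)
  have "(\<integral>\<^sup>+\<omega>. exp_neg (ennreal (c * E \<omega>)) \<partial>M) =
      (\<integral>\<^sup>+x. ennreal (exponential_density 1 x) * exp_neg (ennreal (c * x)) \<partial>lborel)"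
    by (rule distributed_nn_integral[symmetric, OF E]) measurable
  also have "\<dots> = (\<integral>\<^sup>+x. ennreal (1 / (1 + c)) * ennreal (exponential_density (1 + c) x) \<partial>lborel)"
    using c by (intro nn_integral_cong)
      (auto simp: exponential_density_def exp_add[symmetric] field_simps simp flip: ennreal_mult)
  also have "\<dots> = ennreal (1 / (1 + c))"
    by (subst nn_integral_cmult) (auto simp: 1)
  also have "\<dots> = exp_neg (ennreal (ln (1 + c)))"
    using c by (simp add: exp_minus field_simps)
  finally show ?thesis .
qed

lemma (in prob_space) exp_neg_exponential_series:
  fixes C E :: "nat \<Rightarrow> 'a \<Rightarrow> real"
  assumes CE: "indep_var (\<Pi>\<^sub>M n\<in>UNIV. borel) (\<lambda>\<omega> n. C n \<omega>) (\<Pi>\<^sub>M n\<in>UNIV. borel) (\<lambda>\<omega> n. E n \<omega>)"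
    and nonneg: "\<And>n \<omega>. C n \<omega> \<ge> 0"
    and E: "\<And>n. distributed M lborel (E n) (exponential_density 1)"
    and indep: "indep_vars (\<lambda>_. borel) E UNIV"
  shows "(\<integral>\<^sup>+\<omega>. exp_neg (\<Sum>n. ennreal (C n \<omega> * E n \<omega>)) \<partial>M) =
         (\<integral>\<^sup>+\<omega>. exp_neg (\<Sum>n. ennreal (ln (1 + C n \<omega>))) \<partial>M)"
proof -
  let ?P = "\<Pi>\<^sub>M n\<in>(UNIV::nat set). (borel :: real measure)"
  have rv [measurable]: "random_variable ?P (\<lambda>\<omega> n. C n \<omega>)" "random_variable ?P (\<lambda>\<omega> n. E n \<omega>)"
    using CE by (auto simp: indep_var_distribution_eq)
  have [measurable]: "random_variable borel (C n)" for n
    using measurable_compose[OF rv(1) measurable_component_singleton[of n]] by simp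
  have E_rv [measurable]: "random_variable borel (E n)" for n
    using measurable_compose[OF rv(2) measurable_component_singleton[of n]] by simp
  let ?DC = "distr M ?P (\<lambda>\<omega> n. C n \<omega>)" and ?DE = "distr M ?P (\<lambda>\<omega> n. E n \<omega>)"
  interpret DE: prob_space ?DE
    by (rule prob_space_distr) measurable
  have partial: "(\<integral>\<^sup>+\<omega>. exp_neg (\<Sum>n<k. ennreal (C n \<omega> * E n \<omega>)) \<partial>M) =
      (\<integral>\<^sup>+\<omega>. exp_neg (\<Sum>n<k. ennreal (ln (1 + C n \<omega>))) \<partial>M)" for k
  proof -
    have "(\<integral>\<^sup>+\<omega>. exp_neg (\<Sum>n<k. ennreal (C n \<omega> * E n \<omega>)) \<partial>M) =
        (\<integral>\<^sup>+p. exp_neg (\<Sum>n<k. ennreal (fst p n * snd p n))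
           \<partial>distr M (?P \<Otimes>\<^sub>M ?P) (\<lambda>\<omega>. (\<lambda>n. C n \<omega>, \<lambda>n. E n \<omega>)))"
      by (subst nn_integral_distr) auto
    also have "distr M (?P \<Otimes>\<^sub>M ?P) (\<lambda>\<omega>. (\<lambda>n. C n \<omega>, \<lambda>n. E n \<omega>)) = ?DC \<Otimes>\<^sub>M ?DE"
      using CE by (simp add: indep_var_distribution_eq)
    also have "(\<integral>\<^sup>+p. exp_neg (\<Sum>n<k. ennreal (fst p n * snd p n)) \<partial>(?DC \<Otimes>\<^sub>M ?DE)) =
        (\<integral>\<^sup>+c. \<integral>\<^sup>+e. exp_neg (\<Sum>n<k. ennreal (c n * e n)) \<partial>?DE \<partial>?DC)"
      by (subst DE.nn_integral_fst[symmetric]) auto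
    also have "\<dots> = (\<integral>\<^sup>+\<omega>. \<integral>\<^sup>+e. exp_neg (\<Sum>n<k. ennreal (C n \<omega> * e n)) \<partial>?DE \<partial>M)"
      by (subst nn_integral_distr) auto
    also have "\<dots> = (\<integral>\<^sup>+\<omega>. \<integral>\<^sup>+\<omega>'. exp_neg (\<Sum>n<k. ennreal (C n \<omega> * E n \<omega>')) \<partial>M \<partial>M)"
      by (intro nn_integral_cong, subst nn_integral_distr) auto
    also have "\<dots> = (\<integral>\<^sup>+\<omega>. exp_neg (\<Sum>n<k. ennreal (ln (1 + C n \<omega>))) \<partial>M)"
    proof (intro nn_integral_cong)
      fix \<omega>
      have "indep_vars (\<lambda>_. borel) (\<lambda>n \<omega>'. exp_neg (ennreal (C n \<omega> * E n \<omega>'))) {..<k}"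
        by (rule indep_vars_compose2[OF indep_vars_subset[OF indep]]) auto
      then have "(\<integral>\<^sup>+\<omega>'. (\<Prod>n<k. exp_neg (ennreal (C n \<omega> * E n \<omega>'))) \<partial>M) =
          (\<Prod>n<k. \<integral>\<^sup>+\<omega>'. exp_neg (ennreal (C n \<omega> * E n \<omega>')) \<partial>M)"
        by (intro indep_vars_nn_integral) auto
      then show "(\<integral>\<^sup>+\<omega>'. exp_neg (\<Sum>n<k. ennreal (C n \<omega> * E n \<omega>')) \<partial>M) =
          exp_neg (\<Sum>n<k. ennreal (ln (1 + C n \<omega>)))"
        by (simp only: exp_neg_sum exponential_exp_neg[OF E nonneg])
    qed
    finally show ?thesis .
  qed
  have "(\<lambda>k. \<integral>\<^sup>+\<omega>. exp_neg (\<Sum>n<k. ennreal (C n \<omega> * E n \<omega>)) \<partial>M)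
      \<longlonglongrightarrow> (\<integral>\<^sup>+\<omega>. exp_neg (\<Sum>n. ennreal (C n \<omega> * E n \<omega>)) \<partial>M)"
    by (rule nn_integral_exp_neg_LIMSEQ) (auto intro: prob_space_axioms summable_LIMSEQ)
  moreover have "(\<lambda>k. \<integral>\<^sup>+\<omega>. exp_neg (\<Sum>n<k. ennreal (ln (1 + C n \<omega>))) \<partial>M)
      \<longlonglongrightarrow> (\<integral>\<^sup>+\<omega>. exp_neg (\<Sum>n. ennreal (ln (1 + C n \<omega>))) \<partial>M)"
    by (rule nn_integral_exp_neg_LIMSEQ) (auto intro: prob_space_axioms summable_LIMSEQ)
  ultimately show ?thesis
    unfolding partial by (rule LIMSEQ_unique)
qed

lemma exp_neg_marked_sum:
  fixes w :: "'a::euclidean_space \<Rightarrow> real"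
  assumes marks: "iid_exponential_marks N \<Psi> H"
    and w [measurable]: "w \<in> borel_measurable borel" and nonneg: "\<And>x. w x \<ge> 0"
  shows "(\<lambda>\<omega>. \<Sum>\<^sub>\<infinity>x\<in>\<Psi> \<omega>. ennreal (w x * H \<omega> x)) \<in> borel_measurable N"
    and "(\<integral>\<^sup>+\<omega>. exp_neg (\<Sum>\<^sub>\<infinity>x\<in>\<Psi> \<omega>. ennreal (w x * H \<omega> x)) \<partial>N) =
         (\<integral>\<^sup>+\<omega>. exp_neg (\<integral>\<^sup>+x. ennreal (ln (1 + w x)) \<partial>count_space (\<Psi> \<omega>)) \<partial>N)"
proof -
  define has where "has A n \<longleftrightarrow> (finite A \<longrightarrow> n < card A)" for A :: "'a set" and n :: nat
  have pp: "point_process N \<Psi>"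
    using marks by (simp add: iid_exponential_marks_def)
  then interpret prob_space N
    by (simp add: point_process_def)
  have [measurable]: "\<Psi> \<in> measurable N config_space"
    using pp by (simp add: point_process_def)
  obtain X E where
    X [measurable]: "\<And>n. X n \<in> borel_measurable N" and
    bij: "\<And>\<omega>. \<omega> \<in> space N \<Longrightarrow> bij_betw (\<lambda>n. X n \<omega>) {n. has (\<Psi> \<omega>) n} (\<Psi> \<omega>)" and
    H: "\<And>\<omega> n. \<omega> \<in> space N \<Longrightarrow> has (\<Psi> \<omega>) n \<Longrightarrow> H \<omega> (X n \<omega>) = E n \<omega>" and
    E: "\<And>n. distributed N lborel (E n) (exponential_density 1)" and
    indep: "indep_vars (\<lambda>_. borel) E UNIV" and
    XE: "indep_set
          (sets (vimage_algebra (space N) (\<lambda>\<omega>. (\<Psi> \<omega>, \<lambda>n. X n \<omega>))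
             (config_space \<Otimes>\<^sub>M (\<Pi>\<^sub>M n\<in>UNIV. borel))))
          (sets (vimage_algebra (space N) (\<lambda>\<omega> n. E n \<omega>) (\<Pi>\<^sub>M n\<in>UNIV. borel)))"
    using marks unfolding iid_exponential_marks_def has_def by blast
  have [measurable]: "random_variable borel (E n)" for n
    using distributed_measurable[OF E] by simp
  have has_meas [measurable]: "Measurable.pred config_space (\<lambda>A. has A n)" for n
    unfolding has_def by (rule measurable_config_has_nth)
  define C where "C n \<omega> = (if has (\<Psi> \<omega>) n then w (X n \<omega>) else 0)" for n \<omega>
  define F where "F = (\<lambda>(A, x) n. if has A n then w (x n) else 0)"
  have [measurable]: "random_variable borel (C n)" for n
    unfolding C_def by measurable
  let ?Y = "\<lambda>\<omega>. (\<Psi> \<omega>, \<lambda>n. X n \<omega>)" and ?Q = "config_space \<Otimes>\<^sub>M (\<Pi>\<^sub>M n\<in>UNIV. borel) :: ('a set \<times> (nat \<Rightarrow> 'a)) measure"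
  have Y: "?Y \<in> measurable N ?Q"
    by (intro measurable_Pair measurable_PiM_single') auto
  have F: "F \<in> measurable ?Q (\<Pi>\<^sub>M n\<in>UNIV. borel)"
    unfolding F_def split_beta' by (intro measurable_PiM_single') auto
  have "?Y \<in> measurable (vimage_algebra (space N) ?Y ?Q) ?Q"
    using measurable_space[OF Y] by (intro measurable_vimage_algebra1) blast
  from measurable_compose[OF this F]
  have "(\<lambda>\<omega> n. C n \<omega>) \<in> measurable (vimage_algebra (space N) ?Y ?Q) (\<Pi>\<^sub>M n\<in>UNIV. borel)"
    by (simp add: F_def C_def)
  then have "sets (vimage_algebra (space N) (\<lambda>\<omega> n. C n \<omega>) (\<Pi>\<^sub>M n\<in>UNIV. borel)) \<subseteq>
      sets (vimage_algebra (space N) ?Y ?Q)"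
    using sets_image_in_sets[of "vimage_algebra (space N) ?Y ?Q" "space N"] by simp
  then have "indep_set
      (sets (vimage_algebra (space N) (\<lambda>\<omega> n. C n \<omega>) (\<Pi>\<^sub>M n\<in>UNIV. borel)))
      (sets (vimage_algebra (space N) (\<lambda>\<omega> n. E n \<omega>) (\<Pi>\<^sub>M n\<in>UNIV. borel)))"
    using XE unfolding indep_set_def by (elim indep_sets_mono_sets) (auto split: bool.split)
  then have CE: "indep_var (\<Pi>\<^sub>M n\<in>UNIV. borel) (\<lambda>\<omega> n. C n \<omega>) (\<Pi>\<^sub>M n\<in>UNIV. borel) (\<lambda>\<omega> n. E n \<omega>)"
    unfolding indep_var_eq sets_vimage_algebra[symmetric]
    by (intro conjI measurable_PiM_single') auto
  have marked: "(\<Sum>\<^sub>\<infinity>x\<in>\<Psi> \<omega>. ennreal (w x * H \<omega> x)) = (\<Sum>n. ennreal (C n \<omega> * E n \<omega>))"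
    if "\<omega> \<in> space N" for \<omega>
    unfolding infsum_enumeration[OF bij[OF that]]
    by (intro suminf_cong) (auto simp: C_def H that)
  have unmarked: "(\<integral>\<^sup>+x. ennreal (ln (1 + w x)) \<partial>count_space (\<Psi> \<omega>)) = (\<Sum>n. ennreal (ln (1 + C n \<omega>)))"
    if "\<omega> \<in> space N" for \<omega>
    unfolding nn_integral_count_space_enumeration[OF bij[OF that]]
    by (intro suminf_cong) (auto simp: C_def)
  show "(\<lambda>\<omega>. \<Sum>\<^sub>\<infinity>x\<in>\<Psi> \<omega>. ennreal (w x * H \<omega> x)) \<in> borel_measurable N"
    by (subst measurable_cong[OF marked]) auto
  have "(\<integral>\<^sup>+\<omega>. exp_neg (\<Sum>\<^sub>\<infinity>x\<in>\<Psi> \<omega>. ennreal (w x * H \<omega> x)) \<partial>N) =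
      (\<integral>\<^sup>+\<omega>. exp_neg (\<Sum>n. ennreal (C n \<omega> * E n \<omega>)) \<partial>N)"
    by (intro nn_integral_cong) (simp add: marked)
  also have "\<dots> = (\<integral>\<^sup>+\<omega>. exp_neg (\<Sum>n. ennreal (ln (1 + C n \<omega>))) \<partial>N)"
    by (rule exp_neg_exponential_series[OF CE _ E indep]) (auto simp: C_def nonneg)
  also have "\<dots> = (\<integral>\<^sup>+\<omega>. exp_neg (\<integral>\<^sup>+x. ennreal (ln (1 + w x)) \<partial>count_space (\<Psi> \<omega>)) \<partial>N)"
    by (intro nn_integral_cong) (simp add: unmarked)
  finally show "(\<integral>\<^sup>+\<omega>. exp_neg (\<Sum>\<^sub>\<infinity>x\<in>\<Psi> \<omega>. ennreal (w x * H \<omega> x)) \<partial>N) =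
         (\<integral>\<^sup>+\<omega>. exp_neg (\<integral>\<^sup>+x. ennreal (ln (1 + w x)) \<partial>count_space (\<Psi> \<omega>)) \<partial>N)" .
qed

section \<open>The Laplace functional of a Poisson process\<close>

lemma poisson_count_exp_neg:
  assumes "prob_space M" and N [measurable]: "N \<in> measurable M (count_space UNIV)" and "\<mu> \<ge> 0"
    and P: "\<And>n. measure M {\<omega> \<in> space M. N \<omega> = n} = \<mu> ^ n / fact n * exp (- \<mu>)"
    and c: "c < top"
  shows "(\<integral>\<^sup>+\<omega>. exp_neg (c * of_nat (N \<omega>)) \<partial>M) = exp_neg (ennreal \<mu> * (1 - exp_neg c))"
proof -
  interpret prob_space M by fact
  obtain t where t: "c = ennreal t" "t \<ge> 0"
    using c by (cases c) auto
  define p where "p n = \<mu> ^ n / fact n * exp (- \<mu>)" for n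
  have p_nonneg: "p n \<ge> 0" for n
    using \<open>\<mu> \<ge> 0\<close> by (simp add: p_def)
  have law: "distr M (count_space UNIV) N = density (count_space UNIV) (\<lambda>n. ennreal (p n))"
  proof (rule measure_eqI_countable[where A = UNIV])
    fix n :: nat
    have "emeasure (distr M (count_space UNIV) N) {n} = emeasure M {\<omega> \<in> space M. N \<omega> = n}"
      by (subst emeasure_distr) (auto intro!: arg_cong2[where f = emeasure])
    then show "emeasure (distr M (count_space UNIV) N) {n} =
        emeasure (density (count_space UNIV) (\<lambda>n. ennreal (p n))) {n}"
      by (simp add: emeasure_eq_measure P emeasure_density p_def)
  qed auto
  have weight: "exp_neg (c * of_nat n) = ennreal (exp (- t) ^ n)" for n
  proof -
    have "c * of_nat n = ennreal (t * real n)"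
      using t by (simp add: ennreal_mult ennreal_of_nat_eq_real_of_nat)
    then show ?thesis
      using t by (simp add: exp_of_nat_mult[symmetric] algebra_simps)
  qed
  have "(\<lambda>n. (\<mu> * exp (- t)) ^ n /\<^sub>R fact n) sums exp (\<mu> * exp (- t))"
    by (rule exp_converges)
  then have sums: "(\<lambda>n. p n * exp (- t) ^ n) sums (exp (\<mu> * exp (- t)) * exp (- \<mu>))"
    by (drule_tac sums_mult2[where c = "exp (- \<mu>)"])
       (simp add: p_def power_mult_distrib divide_inverse mult_ac)
  have "(\<integral>\<^sup>+\<omega>. exp_neg (c * of_nat (N \<omega>)) \<partial>M) =
      (\<integral>\<^sup>+n. exp_neg (c * of_nat n) \<partial>distr M (count_space UNIV) N)"
    by (subst nn_integral_distr) auto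
  also have "\<dots> = (\<Sum>n. ennreal (p n) * exp_neg (c * of_nat n))"
    unfolding law by (subst nn_integral_density) (auto simp: nn_integral_count_space_nat)
  also have "\<dots> = (\<Sum>n. ennreal (p n * exp (- t) ^ n))"
    by (simp add: weight ennreal_mult p_nonneg)
  also have "\<dots> = ennreal (exp (\<mu> * exp (- t)) * exp (- \<mu>))"
    using sums by (intro suminf_ennreal_eq) (auto simp: p_nonneg)
  also have "\<dots> = exp_neg (ennreal \<mu> * (1 - exp_neg c))"
  proof -
    have "ennreal \<mu> * (1 - exp_neg c) = ennreal (\<mu> * (1 - exp (- t)))"
      using t \<open>\<mu> \<ge> 0\<close> by (simp add: ennreal_mult ennreal_minus flip: ennreal_1)
    moreover have "\<mu> * (1 - exp (- t)) \<ge> 0"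
      using t \<open>\<mu> \<ge> 0\<close> by simp
    ultimately have "exp_neg (ennreal \<mu> * (1 - exp_neg c)) = ennreal (exp (- (\<mu> * (1 - exp (- t)))))"
      by (simp only: exp_neg_ennreal)
    then show ?thesis
      by (simp add: exp_add[symmetric] algebra_simps)
  qed
  finally show ?thesis .
qed

lemma poisson_laplace_functional_simple:
  fixes g :: "'a::euclidean_space \<Rightarrow> ennreal"
  assumes poisson: "homogeneous_poisson_process lam M \<Phi>" and "lam \<ge> 0"
    and simple: "simple_function borel g" and bdd: "bounded {x. g x \<noteq> 0}" and fin: "\<And>x. g x < top"
  shows "(\<integral>\<^sup>+\<omega>. exp_neg (\<integral>\<^sup>+x. g x \<partial>count_space (\<Phi> \<omega>)) \<partial>M) =
         exp_neg (ennreal lam * (\<integral>\<^sup>+x. 1 - exp_neg (g x) \<partial>lborel))"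
proof -
  interpret prob_space M
    using poisson by (simp add: homogeneous_poisson_process_def point_process_def)
  have [measurable]: "\<Phi> \<in> measurable M config_space"
    using poisson by (simp add: homogeneous_poisson_process_def point_process_def)
  define C where "C = range g - {0}"
  define B where "B c = g -` {c}" for c
  have fin_range: "finite (range g)"
    using simple by (simp add: simple_function_def)
  have fin_C: "finite C"
    using fin_range by (simp add: C_def)
  have inj: "inj_on B C"
    by (auto simp: inj_on_def B_def C_def)
  have B_sets [measurable]: "B c \<in> sets borel" for c
    using borel_measurable_simple_function[OF simple] measurable_sets_borel[of g borel] by (simp add: B_def)
  have B_bdd: "bounded (B c)" if "c \<in> C" for c
    using that by (intro bounded_subset[OF bdd]) (auto simp: B_def C_def)
  have count_meas [measurable]: "(\<lambda>\<omega>. card (\<Phi> \<omega> \<inter> B c)) \<in> measurable M (count_space UNIV)" if "c \<in> C" for c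
    by (rule measurable_compose[OF _ measurable_config_count]) (auto simp: B_bdd that)
  have disj: "disjoint (B ` C)"
    by (auto simp: disjoint_def B_def)
  have indep: "indep_vars (\<lambda>_. count_space UNIV) (\<lambda>D \<omega>. card (\<Phi> \<omega> \<inter> D)) (B ` C)"
    using poisson disj fin_C B_bdd B_sets unfolding homogeneous_poisson_process_def by blast
  have "indep_vars (\<lambda>_. borel) (\<lambda>D \<omega>. exp_neg (inv_into C B D * of_nat (card (\<Phi> \<omega> \<inter> D)))) (B ` C)"
    by (rule indep_vars_compose2[OF indep]) auto
  then have "(\<integral>\<^sup>+\<omega>. (\<Prod>D\<in>B ` C. exp_neg (inv_into C B D * of_nat (card (\<Phi> \<omega> \<inter> D)))) \<partial>M) =
      (\<Prod>D\<in>B ` C. \<integral>\<^sup>+\<omega>. exp_neg (inv_into C B D * of_nat (card (\<Phi> \<omega> \<inter> D))) \<partial>M)"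
    using fin_C by (intro indep_vars_nn_integral) auto
  then have product: "(\<integral>\<^sup>+\<omega>. (\<Prod>c\<in>C. exp_neg (c * of_nat (card (\<Phi> \<omega> \<inter> B c)))) \<partial>M) =
      (\<Prod>c\<in>C. \<integral>\<^sup>+\<omega>. exp_neg (c * of_nat (card (\<Phi> \<omega> \<inter> B c))) \<partial>M)"
    by (simp add: prod.reindex[OF inj] inv_into_f_f[OF inj])
  have "(\<integral>\<^sup>+\<omega>. exp_neg (\<integral>\<^sup>+x. g x \<partial>count_space (\<Phi> \<omega>)) \<partial>M) =
      (\<integral>\<^sup>+\<omega>. (\<Prod>c\<in>C. exp_neg (c * of_nat (card (\<Phi> \<omega> \<inter> B c)))) \<partial>M)"
  proof (intro nn_integral_cong)
    fix \<omega> assume "\<omega> \<in> space M"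
    then have "locally_finite (\<Phi> \<omega>)"
      using measurable_space[of \<Phi> M config_space \<omega>] by (simp add: space_config_space)
    then show "exp_neg (\<integral>\<^sup>+x. g x \<partial>count_space (\<Phi> \<omega>)) =
        (\<Prod>c\<in>C. exp_neg (c * of_nat (card (\<Phi> \<omega> \<inter> B c))))"
      by (simp add: nn_integral_count_space_simple[OF fin_range bdd] exp_neg_sum C_def B_def)
  qed
  also have "\<dots> = (\<Prod>c\<in>C. \<integral>\<^sup>+\<omega>. exp_neg (c * of_nat (card (\<Phi> \<omega> \<inter> B c))) \<partial>M)"
    by (rule product)
  also have "\<dots> = (\<Prod>c\<in>C. exp_neg (ennreal (lam * measure lborel (B c)) * (1 - exp_neg c)))"
  proof (intro prod.cong refl poisson_count_exp_neg)
    fix c n assume c: "c \<in> C"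
    show "prob {\<omega> \<in> space M. card (\<Phi> \<omega> \<inter> B c) = n} =
        (lam * measure lborel (B c)) ^ n / fact n * exp (- (lam * measure lborel (B c)))"
      using poisson B_bdd[OF c] B_sets unfolding homogeneous_poisson_process_def by blast
    show "c < top"
      using c fin by (auto simp: C_def)
  qed (use \<open>lam \<ge> 0\<close> in \<open>auto intro: prob_space_axioms count_meas\<close>)
  also have "\<dots> = exp_neg (\<Sum>c\<in>C. ennreal (lam * measure lborel (B c)) * (1 - exp_neg c))"
    by (simp add: exp_neg_sum)
  also have "(\<Sum>c\<in>C. ennreal (lam * measure lborel (B c)) * (1 - exp_neg c)) =
      ennreal lam * (\<Sum>c\<in>C. (1 - exp_neg c) * emeasure lborel (B c))"
    unfolding sum_distrib_left
  proof (intro sum.cong refl)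
    fix c assume "c \<in> C"
    then have "emeasure lborel (B c) = ennreal (measure lborel (B c))"
      using emeasure_bounded_finite[OF B_bdd] by (intro emeasure_eq_ennreal_measure) (auto simp: less_top[symmetric])
    then show "ennreal (lam * measure lborel (B c)) * (1 - exp_neg c) =
        ennreal lam * ((1 - exp_neg c) * emeasure lborel (B c))"
      using \<open>lam \<ge> 0\<close> by (simp add: ennreal_mult mult_ac)
  qed
  also have "(\<Sum>c\<in>C. (1 - exp_neg c) * emeasure lborel (B c)) = (\<integral>\<^sup>+x. 1 - exp_neg (g x) \<partial>lborel)"
  proof -
    have "1 - exp_neg (g x) = (\<Sum>c\<in>C. (1 - exp_neg c) * indicator (B c) x)" for x
    proof -
      have "(\<Sum>c\<in>C. (1 - exp_neg c) * indicator (B c) x) = (\<Sum>c\<in>C. if c = g x then 1 - exp_neg c else 0)"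
        by (intro sum.cong) (auto simp: B_def)
      also have "\<dots> = 1 - exp_neg (g x)"
        using fin_C by (subst sum.delta) (auto simp: C_def)
      finally show ?thesis ..
    qed
    then show ?thesis
      by (simp add: nn_integral_sum nn_integral_cmult_indicator)
  qed
  finally show ?thesis .
qed

lemma poisson_laplace_functional:
  fixes f :: "'a::euclidean_space \<Rightarrow> ennreal"
  assumes poisson: "homogeneous_poisson_process lam M \<Phi>" and "lam \<ge> 0"
    and f [measurable]: "f \<in> borel_measurable borel"
  shows "(\<integral>\<^sup>+\<omega>. exp_neg (\<integral>\<^sup>+x. f x \<partial>count_space (\<Phi> \<omega>)) \<partial>M) =
         exp_neg (ennreal lam * (\<integral>\<^sup>+x. 1 - exp_neg (f x) \<partial>lborel))"
proof -
  have pp: "prob_space M" "\<Phi> \<in> measurable M config_space"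
    using poisson by (simp_all add: homogeneous_poisson_process_def point_process_def)
  obtain g where g: "incseq g" "\<And>i x. g i x < top" "\<And>i. simple_function borel (g i)"
      "\<And>i. bounded {x. g i x \<noteq> 0}" "\<And>x. (SUP i. g i x) = f x"
    using bounded_simple_approximation[OF f] by metis
  have [measurable]: "g i \<in> borel_measurable borel" for i
    using g(3) by (rule borel_measurable_simple_function)
  have lim: "(\<lambda>i. g i x) \<longlonglongrightarrow> f x" for x
    unfolding g(5)[symmetric] using g(1) by (intro LIMSEQ_SUP) (auto simp: incseq_def le_fun_def)
  have "(\<lambda>i. \<integral>\<^sup>+\<omega>. exp_neg (\<integral>\<^sup>+x. g i x \<partial>count_space (\<Phi> \<omega>)) \<partial>M)
      \<longlonglongrightarrow> (\<integral>\<^sup>+\<omega>. exp_neg (\<integral>\<^sup>+x. f x \<partial>count_space (\<Phi> \<omega>)) \<partial>M)"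
  proof (rule nn_integral_exp_neg_LIMSEQ)
    show "(\<lambda>\<omega>. \<integral>\<^sup>+x. g i x \<partial>count_space (\<Phi> \<omega>)) \<in> borel_measurable M" for i
      using pp(2) by measurable
    show "(\<lambda>i. \<integral>\<^sup>+x. g i x \<partial>count_space (\<Phi> \<omega>)) \<longlonglongrightarrow> (\<integral>\<^sup>+x. f x \<partial>count_space (\<Phi> \<omega>))" for \<omega>
      using g(1) lim by (intro nn_integral_LIMSEQ) (auto simp: incseq_def le_fun_def)
  qed (rule pp)
  moreover have "(\<lambda>i. \<integral>\<^sup>+x. 1 - exp_neg (g i x) \<partial>lborel) \<longlonglongrightarrow> (\<integral>\<^sup>+x. 1 - exp_neg (f x) \<partial>lborel)"
  proof (rule nn_integral_LIMSEQ)
    show "incseq (\<lambda>i x. 1 - exp_neg (g i x))"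
      using g(1) by (auto simp: incseq_def le_fun_def intro!: ennreal_minus_mono exp_neg_antimono)
    show "(\<lambda>i. 1 - exp_neg (g i x)) \<longlonglongrightarrow> 1 - exp_neg (f x)" for x
      by (intro tendsto_diff_ennreal tendsto_const tendsto_exp_neg lim) simp_all
  qed auto
  then have "(\<lambda>i. \<integral>\<^sup>+\<omega>. exp_neg (\<integral>\<^sup>+x. g i x \<partial>count_space (\<Phi> \<omega>)) \<partial>M)
      \<longlonglongrightarrow> exp_neg (ennreal lam * (\<integral>\<^sup>+x. 1 - exp_neg (f x) \<partial>lborel))"
    unfolding poisson_laplace_functional_simple[OF poisson \<open>lam \<ge> 0\<close> g(3) g(4) g(2)]
    by (intro tendsto_exp_neg ennreal_tendsto_cmult) auto
  ultimately show ?thesis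
    by (rule LIMSEQ_unique)
qed

lemma conditioned_poisson_laplace_functional:
  fixes f :: "'a::euclidean_space \<Rightarrow> ennreal"
  assumes poisson: "homogeneous_poisson_process lam M \<Phi>" and "lam \<ge> 0"
    and cond: "conditioned_outside_ball M \<Phi> r N \<Psi>"
    and f [measurable]: "f \<in> borel_measurable borel"
  shows "(\<integral>\<^sup>+\<omega>. exp_neg (\<integral>\<^sup>+x. f x \<partial>count_space (\<Psi> \<omega>)) \<partial>N) =
         exp_neg (ennreal lam * (\<integral>\<^sup>+x. (1 - exp_neg (f x)) * indicator (- ball 0 r) x \<partial>lborel))"
proof -
  have [measurable]: "\<Phi> \<in> measurable M config_space" "\<Psi> \<in> measurable N config_space"
    using poisson cond
    by (simp_all add: homogeneous_poisson_process_def conditioned_outside_ball_def point_process_def)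
  have [measurable]: "ball (0::'a) r \<in> sets borel"
    by simp
  define K where "K = {A \<in> space config_space. A \<inter> ball (0::'a) r = {}}"
  define h where "h f A = exp_neg (\<integral>\<^sup>+x. f x \<partial>count_space A)" for f and A :: "'a set"
  define outside where "outside f x = (if x \<in> ball 0 r then top else f x)" for f :: "'a \<Rightarrow> ennreal" and x
  have h_meas [measurable]: "h f \<in> borel_measurable config_space" if "f \<in> borel_measurable borel" for f
    using that unfolding h_def by measurable
  have outside_meas [measurable]: "outside f \<in> borel_measurable borel" if "f \<in> borel_measurable borel" for f
    using that unfolding outside_def mem_ball by measurable
  have [measurable]: "K \<in> sets config_space"
  proof -
    have "card (A \<inter> ball (0::'a) r) = 0 \<longleftrightarrow> A \<inter> ball 0 r = {}" if "A \<in> space config_space" for A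
      using that by (intro card_0_eq) (simp add: space_config_space locally_finite_def)
    then have "K = {A \<in> space config_space. card (A \<inter> ball 0 r) = 0}"
      unfolding K_def by blast
    moreover have [measurable]: "(\<lambda>A. card (A \<inter> ball (0::'a) r)) \<in> measurable config_space (count_space UNIV)"
      by (intro measurable_config_count) auto
    ultimately show ?thesis
      by simp
  qed
  have h_outside: "h (outside f) A = h f A * indicator K A" if "A \<in> space config_space" for f A
  proof (cases "A \<in> K")
    case True
    then have "x \<notin> ball 0 r" if "x \<in> A" for x
      using that by (auto simp: K_def simp del: mem_ball_0)
    then have "(\<integral>\<^sup>+x. outside f x \<partial>count_space A) = (\<integral>\<^sup>+x. f x \<partial>count_space A)"
      by (intro nn_integral_cong) (auto simp: outside_def)
    then show ?thesis
      using True by (simp add: h_def)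
  next
    case False
    then obtain x where x: "x \<in> A" "x \<in> ball 0 r"
      using \<open>A \<in> space config_space\<close> by (auto simp: K_def)
    then have "top \<le> (\<integral>\<^sup>+x. outside f x \<partial>count_space A)"
      using nn_integral_ge_point[OF x(1), of "outside f"] by (simp add: outside_def)
    then show ?thesis
      using False by (simp add: h_def top_unique)
  qed
  have outside_integral: "(\<integral>\<^sup>+x. 1 - exp_neg (outside f x) \<partial>lborel) =
      emeasure lborel (ball (0::'a) r) + (\<integral>\<^sup>+x. (1 - exp_neg (f x)) * indicator (- ball 0 r) x \<partial>lborel)"
    if [measurable]: "f \<in> borel_measurable borel" for f
  proof -
    have "(\<integral>\<^sup>+x. 1 - exp_neg (outside f x) \<partial>lborel) =
        (\<integral>\<^sup>+x. indicator (ball 0 r) x + (1 - exp_neg (f x)) * indicator (- ball 0 r) x \<partial>lborel)"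
      by (intro nn_integral_cong) (auto simp: outside_def split: split_indicator)
    also have "\<dots> = (\<integral>\<^sup>+x. indicator (ball (0::'a) r) x \<partial>lborel) +
        (\<integral>\<^sup>+x. (1 - exp_neg (f x)) * indicator (- ball 0 r) x \<partial>lborel)"
      by (rule nn_integral_add) measurable
    finally show ?thesis
      by simp
  qed
  let ?P = "distr M config_space \<Phi>"
  define b where "b = exp_neg (ennreal lam * emeasure lborel (ball (0::'a) r))"
  have P: "(\<integral>\<^sup>+A. h f A * indicator K A \<partial>?P) =
      b * exp_neg (ennreal lam * (\<integral>\<^sup>+x. (1 - exp_neg (f x)) * indicator (- ball 0 r) x \<partial>lborel))"
    if f [measurable]: "f \<in> borel_measurable borel" for f
  proof -
    have "(\<integral>\<^sup>+A. h f A * indicator K A \<partial>?P) = (\<integral>\<^sup>+A. h (outside f) A \<partial>?P)"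
      by (intro nn_integral_cong) (simp add: h_outside)
    also have "\<dots> = (\<integral>\<^sup>+\<omega>. exp_neg (\<integral>\<^sup>+x. outside f x \<partial>count_space (\<Phi> \<omega>)) \<partial>M)"
      by (subst nn_integral_distr) (auto simp: h_def)
    also have "\<dots> = exp_neg (ennreal lam * (\<integral>\<^sup>+x. 1 - exp_neg (outside f x) \<partial>lborel))"
      by (intro poisson_laplace_functional[OF poisson \<open>lam \<ge> 0\<close>]) measurable
    finally show ?thesis
      by (simp add: outside_integral[OF f] distrib_left exp_neg_add b_def)
  qed
  have "emeasure lborel (ball (0::'a) r) < \<infinity>"
    by (intro emeasure_bounded_finite) simp
  then have b: "b \<noteq> 0" "b \<noteq> top"
    by (auto simp: b_def ennreal_mult_eq_top_iff)
  have "emeasure ?P K = (\<integral>\<^sup>+A. h (\<lambda>_. 0) A * indicator K A \<partial>?P)"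
    by (simp add: h_def)
  also have "\<dots> = b"
    by (subst P) auto
  finally have PK: "emeasure ?P K = b" .
  have "(\<integral>\<^sup>+\<omega>. exp_neg (\<integral>\<^sup>+x. f x \<partial>count_space (\<Psi> \<omega>)) \<partial>N) = (\<integral>\<^sup>+A. h f A \<partial>distr N config_space \<Psi>)"
    by (subst nn_integral_distr) (auto simp: h_def)
  also have "distr N config_space \<Psi> = uniform_measure ?P K"
    using cond by (simp add: conditioned_outside_ball_def K_def)
  also have "(\<integral>\<^sup>+A. h f A \<partial>uniform_measure ?P K) = (\<integral>\<^sup>+A. h f A * indicator K A \<partial>?P) / b"
    by (subst nn_integral_uniform_measure) (auto simp: PK)
  also have "\<dots> = exp_neg (ennreal lam * (\<integral>\<^sup>+x. (1 - exp_neg (f x)) * indicator (- ball 0 r) x \<partial>lborel))"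
    using b by (simp add: P[OF f] mult.commute[of b] mult_divide_eq_ennreal)
  finally show ?thesis .
qed

section \<open>Radial integration\<close>

lemma distr_norm_lborel:
  defines "d \<equiv> DIM('a::euclidean_space)"
  shows "distr (lborel :: 'a measure) borel norm =
    density lborel (\<lambda>u. ennreal (real d * unit_ball_vol (real d) * u ^ (d - 1)) * indicator {0..} u)"
    (is "?D = ?R")
proof (rule measure_eqI_generator_eq[where \<Omega> = UNIV and E = "range atMost" and A = "\<lambda>i. {..real i}"])
  define F where "F u = unit_ball_vol (real d) * u ^ d" for u
  have vol: "unit_ball_vol (real d) \<ge> 0"
    by simp
  have "d > 0"
    by (simp add: d_def)
  have D: "emeasure ?D {..a} = ennreal (if a < 0 then 0 else F a)" for a
  proof -
    have "emeasure ?D {..a} = emeasure (lborel :: 'a measure) (cball 0 a)"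
      by (subst emeasure_distr) (auto intro!: arg_cong2[where f = emeasure])
    then show ?thesis
      by (auto simp: emeasure_cball F_def d_def)
  qed
  have R: "emeasure ?R {..a} = ennreal (if a < 0 then 0 else F a)" for a
  proof -
    have "emeasure ?R {..a} =
        (\<integral>\<^sup>+u. ennreal (real d * unit_ball_vol (real d) * u ^ (d - 1)) * indicator {0..} u * indicator {..a} u \<partial>lborel)"
      by (subst emeasure_density) auto
    also have "\<dots> = (\<integral>\<^sup>+u. ennreal (real d * unit_ball_vol (real d) * u ^ (d - 1)) * indicator {0..a} u \<partial>lborel)"
      by (intro nn_integral_cong) (auto split: split_indicator)
    also have "\<dots> = ennreal (if a < 0 then 0 else F a)"
    proof (cases "a < 0")
      case False
      have "(\<integral>\<^sup>+u. ennreal (real d * unit_ball_vol (real d) * u ^ (d - 1)) * indicator {0..a} u \<partial>lborel) = F a - F 0"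
        using False vol unfolding F_def
        by (intro nn_integral_FTC_Icc) (auto intro!: derivative_eq_intros)
      then show ?thesis
        using False \<open>d > 0\<close> by (simp add: F_def)
    qed simp
    finally show ?thesis .
  qed
  show "emeasure ?D X = emeasure ?R X" if "X \<in> range atMost" for X
    using that D R by auto
  show "emeasure ?D {..real i} \<noteq> \<infinity>" for i
    by (simp add: D)
  show "(\<Union>i. {..real i}) = UNIV"
    using real_arch_simple by auto
  show "Int_stable (range atMost :: real set set)"
    by (auto simp: Int_stable_def)
  show "sets ?D = sigma_sets UNIV (range atMost)" "sets ?R = sigma_sets UNIV (range atMost)"
    by (simp_all add: borel_eq_atMost)
qed auto

lemma nn_integral_radial:
  assumes [measurable]: "g \<in> borel_measurable borel"
  shows "(\<integral>\<^sup>+x. g (norm x) \<partial>(lborel :: (real^2) measure)) =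
    (\<integral>\<^sup>+u. ennreal (2 * pi * u) * indicator {0..} u * g u \<partial>lborel)"
proof -
  have "(\<integral>\<^sup>+x. g (norm x) \<partial>(lborel :: (real^2) measure)) = (\<integral>\<^sup>+u. g u \<partial>distr (lborel :: (real^2) measure) borel norm)"
    by (subst nn_integral_distr) auto
  then show ?thesis
    by (simp add: distr_norm_lborel unit_ball_vol_2 nn_integral_density)
qed

lemma interference_integral:
  fixes k \<alpha> r :: real
  defines "\<psi> \<equiv> (\<lambda>u. k * u powr (1 - \<alpha>) / (1 + k * u powr (-\<alpha>)))"
  assumes k: "k > 0" and \<alpha>: "\<alpha> > 2" and r: "r \<ge> 0"
  shows "(\<integral>\<^sup>+u. ennreal (\<psi> u) * indicator {r<..} u \<partial>lborel) = ennreal (LBINT u=ereal r..\<infinity>. \<psi> u)"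
    and "(LBINT u=ereal r..\<infinity>. \<psi> u) \<ge> 0"
proof -
  have [measurable]: "\<psi> \<in> borel_measurable borel"
    unfolding \<psi>_def by measurable
  have \<psi>_nonneg: "\<psi> u \<ge> 0" for u
    using k by (simp add: \<psi>_def)
  have bound_near: "\<psi> u \<le> 1" if "0 < u" "u \<le> 1" for u
  proof -
    define v where "v = k * u powr (-\<alpha>)"
    have "v \<ge> 0"
      using k by (simp add: v_def)
    have "\<psi> u = u * (v / (1 + v))"
      using that by (simp add: \<psi>_def v_def powr_diff powr_minus field_simps)
    also have "\<dots> \<le> 1 * 1"
      using \<open>v \<ge> 0\<close> that by (intro mult_mono) (auto simp: field_simps)
    finally show ?thesis
      by simp
  qed
  have bound_far: "\<psi> u \<le> k * u powr (1 - \<alpha>)" for u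
  proof -
    have "\<psi> u \<le> k * u powr (1 - \<alpha>) / 1"
      unfolding \<psi>_def using k by (intro divide_left_mono) (auto intro: add_pos_nonneg)
    then show ?thesis
      by simp
  qed
  have "((\<lambda>u::real. u powr (2 - \<alpha>)) \<longlongrightarrow> 0) at_top"
    using \<alpha> by (intro tendsto_neg_powr filterlim_ident) auto
  from tendsto_mult_right_zero[OF this, of "k / (2 - \<alpha>)"]
  have lim: "((\<lambda>u. k * u powr (2 - \<alpha>) / (2 - \<alpha>)) \<longlongrightarrow> 0) at_top"
    by simp
  have tail: "(\<integral>\<^sup>+u. ennreal (k * u powr (1 - \<alpha>)) * indicator {1..} u \<partial>lborel) =
      ennreal (0 - k * 1 powr (2 - \<alpha>) / (2 - \<alpha>))"
  proof (rule nn_integral_FTC_atLeast[OF _ _ _ lim])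
    fix u :: real assume "1 \<le> u"
    then have "((\<lambda>u. k / (2 - \<alpha>) * u powr (2 - \<alpha>)) has_real_derivative
        k / (2 - \<alpha>) * ((2 - \<alpha>) * u powr (2 - \<alpha> - 1))) (at u)"
      by (intro DERIV_cmult has_real_derivative_powr) auto
    moreover have "2 - \<alpha> - 1 = 1 - \<alpha>"
      by simp
    ultimately show "((\<lambda>u. k * u powr (2 - \<alpha>) / (2 - \<alpha>)) has_real_derivative k * u powr (1 - \<alpha>)) (at u)"
      using \<alpha> by simp
  qed (use k in auto)
  have "(\<integral>\<^sup>+u. ennreal (\<psi> u) * indicator {r<..} u \<partial>lborel) \<le>
      (\<integral>\<^sup>+u. indicator {0..1} u + ennreal (k * u powr (1 - \<alpha>)) * indicator {1..} u \<partial>lborel)"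
  proof (intro nn_integral_mono)
    fix u
    consider "u \<le> r" | "u > r" "u \<le> 1" | "u > 1"
      by linarith
    then show "ennreal (\<psi> u) * indicator {r<..} u \<le>
        indicator {0..1} u + ennreal (k * u powr (1 - \<alpha>)) * indicator {1..} u"
    proof cases
      case 2
      then have "ennreal (\<psi> u) \<le> 1"
        using bound_near[of u] r by (simp add: ennreal_le_1)
      then show ?thesis
        using 2 r by (auto intro: add_increasing2)
    next
      case 3
      then show ?thesis
        using ennreal_leI[OF bound_far[of u]] by (auto split: split_indicator)
    qed simp
  qed
  also have "\<dots> = 1 + ennreal (0 - k * 1 powr (2 - \<alpha>) / (2 - \<alpha>))"
    by (subst nn_integral_add) (auto simp: tail)
  also have "\<dots> < \<infinity>"
    by simp
  finally have fin: "(\<integral>\<^sup>+u. ennreal (\<psi> u) * indicator {r<..} u \<partial>lborel) < \<infinity>" .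
  have eq: "(\<integral>\<^sup>+u. ennreal (\<psi> u) * indicator {r<..} u \<partial>lborel) =
      (\<integral>\<^sup>+u. ennreal (indicator {r<..} u * \<psi> u) \<partial>lborel)"
    by (intro nn_integral_cong) (auto split: split_indicator)
  have LB: "(LBINT u=ereal r..\<infinity>. \<psi> u) = (\<integral>u. indicator {r<..} u * \<psi> u \<partial>lborel)"
    by (simp add: interval_lebesgue_integral_def set_lebesgue_integral_def)
  have "integrable lborel (\<lambda>u. indicator {r<..} u * \<psi> u)"
    using fin \<psi>_nonneg unfolding eq by (intro integrableI_nonneg) auto
  then show "(\<integral>\<^sup>+u. ennreal (\<psi> u) * indicator {r<..} u \<partial>lborel) = ennreal (LBINT u=ereal r..\<infinity>. \<psi> u)"
    unfolding eq LB using \<psi>_nonneg by (intro nn_integral_eq_integral) auto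
  show "(LBINT u=ereal r..\<infinity>. \<psi> u) \<ge> 0"
    unfolding LB using \<psi>_nonneg by (intro integral_nonneg_AE) auto
qed

lemma laplace_interference:
  fixes \<Phi> :: "'w \<Rightarrow> (real^2) set" and \<Psi> :: "'v \<Rightarrow> (real^2) set"
  assumes poisson: "homogeneous_poisson_process lam M \<Phi>"
    and pos: "lam > 0" "p > 0" "\<alpha> > 2" "\<xi> > 0" "r \<ge> 0"
    and cond: "conditioned_outside_ball M \<Phi> r N \<Psi>"
    and marks: "iid_exponential_marks N \<Psi> H"
  shows "laplace_transform N (interference p \<alpha> \<Psi> H) \<xi> =
    exp (- 2 * pi * lam * (LBINT u=ereal r..\<infinity>. p * \<xi> * u powr (1 - \<alpha>) / (1 + p * \<xi> * u powr (-\<alpha>))))"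
    (is "_ = exp (- 2 * pi * lam * ?J)")
proof -
  let ?\<psi> = "\<lambda>u. p * \<xi> * u powr (1 - \<alpha>) / (1 + p * \<xi> * u powr (-\<alpha>))"
  define w where "w x = p * \<xi> * norm x powr (-\<alpha>)" for x :: "real^2"
  define q where "q u = p * \<xi> * u powr (-\<alpha>) / (1 + p * \<xi> * u powr (-\<alpha>))" for u
  have w_meas [measurable]: "w \<in> borel_measurable borel"
    unfolding w_def by measurable
  have w_nonneg: "w x \<ge> 0" for x
    using pos by (simp add: w_def)
  have "(\<lambda>\<omega>. \<Sum>\<^sub>\<infinity>x\<in>\<Psi> \<omega>. ennreal (p * norm x powr (-\<alpha>) * H \<omega> x)) \<in> borel_measurable N"
    using pos by (intro exp_neg_marked_sum[OF marks]) auto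
  then have I_meas: "interference p \<alpha> \<Psi> H \<in> borel_measurable N"
    unfolding interference_def by (simp add: mult_ac)
  have scale: "ennreal \<xi> * interference p \<alpha> \<Psi> H \<omega> = (\<Sum>\<^sub>\<infinity>x\<in>\<Psi> \<omega>. ennreal (w x * H \<omega> x))" for \<omega>
    using pos unfolding interference_def infsum_cmult_ennreal w_def
    by (intro infsum_cong) (simp add: ennreal_mult'[symmetric] mult_ac)
  have void: "1 - exp_neg (ennreal (ln (1 + w x))) = ennreal (q (norm x))" for x
  proof -
    have "exp_neg (ennreal (ln (1 + w x))) = ennreal (1 / (1 + w x))"
      using w_nonneg[of x] by (simp add: exp_minus field_simps)
    moreover have "q (norm x) = w x / (1 + w x)"
      by (simp add: q_def w_def)
    then have "1 - 1 / (1 + w x) = q (norm x)"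
      using w_nonneg[of x] by (simp add: field_simps)
    ultimately show ?thesis
      using w_nonneg[of x] by (metis ennreal_1 ennreal_minus zero_le_divide_1_iff add_nonneg_nonneg zero_le_one)
  qed
  have "laplace_transform N (interference p \<alpha> \<Psi> H) \<xi> =
      enn2real (\<integral>\<^sup>+\<omega>. exp_neg (\<Sum>\<^sub>\<infinity>x\<in>\<Psi> \<omega>. ennreal (w x * H \<omega> x)) \<partial>N)"
    by (simp add: laplace_transform_eq_nn_integral[OF I_meas] pos scale)
  also have "(\<integral>\<^sup>+\<omega>. exp_neg (\<Sum>\<^sub>\<infinity>x\<in>\<Psi> \<omega>. ennreal (w x * H \<omega> x)) \<partial>N) =
      (\<integral>\<^sup>+\<omega>. exp_neg (\<integral>\<^sup>+x. ennreal (ln (1 + w x)) \<partial>count_space (\<Psi> \<omega>)) \<partial>N)"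
    by (rule exp_neg_marked_sum[OF marks]) (auto simp: w_nonneg)
  also have "\<dots> = exp_neg (ennreal lam *
      (\<integral>\<^sup>+x. (1 - exp_neg (ennreal (ln (1 + w x)))) * indicator (- ball 0 r) x \<partial>lborel))"
    using pos by (intro conditioned_poisson_laplace_functional[OF poisson _ cond]) auto
  also have "(\<integral>\<^sup>+x. (1 - exp_neg (ennreal (ln (1 + w x)))) * indicator (- ball 0 r) x \<partial>lborel) =
      (\<integral>\<^sup>+x. ennreal (q (norm x)) * indicator {r..} (norm x) \<partial>(lborel :: (real^2) measure))"
    unfolding void by (intro nn_integral_cong) (auto split: split_indicator)
  also have "\<dots> = (\<integral>\<^sup>+u. ennreal (2 * pi * u) * indicator {0..} u * (ennreal (q u) * indicator {r..} u) \<partial>lborel)"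
    unfolding q_def by (rule nn_integral_radial) measurable
  also have "\<dots> = (\<integral>\<^sup>+u. ennreal (2 * pi) * (ennreal (?\<psi> u) * indicator {r<..} u) \<partial>lborel)"
  proof (intro nn_integral_cong_AE)
    have "ennreal (2 * pi * u) * ennreal (q u) = ennreal (2 * pi) * ennreal (?\<psi> u)" if "u > 0" for u
    proof -
      have "2 * pi * u * q u = 2 * pi * (u * q u)"
        by (simp only: mult.assoc)
      also have "u * q u = ?\<psi> u"
        using that by (simp add: q_def powr_diff powr_minus field_simps)
      finally have "2 * pi * u * q u = 2 * pi * ?\<psi> u" .
      then show ?thesis
        using that by (metis ennreal_mult' less_imp_le mult_nonneg_nonneg pi_ge_zero zero_le_numeral)
    qed
    moreover have "AE u in lborel. u \<noteq> r"
      by (rule AE_lborel_singleton)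
    ultimately show "AE u in lborel. ennreal (2 * pi * u) * indicator {0..} u * (ennreal (q u) * indicator {r..} u) =
        ennreal (2 * pi) * (ennreal (?\<psi> u) * indicator {r<..} u)"
      using pos by (auto elim!: eventually_mono split: split_indicator)
  qed
  also have "\<dots> = ennreal (2 * pi * ?J)"
    using interference_integral[of "p * \<xi>" \<alpha> r] pos
    by (subst nn_integral_cmult) (auto simp: ennreal_mult)
  also have "enn2real (exp_neg (ennreal lam * ennreal (2 * pi * ?J))) = exp (- 2 * pi * lam * ?J)"
    using interference_integral(2)[of "p * \<xi>" \<alpha> r] pos
    by (simp add: ennreal_mult[symmetric] mult_ac)
  finally show ?thesis .
qed

theorem lemma2:
  fixes lam p_p p_g \<alpha> \<eta> \<xi> R :: real
    and U :: "real^2"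
    and M :: "'w measure" and \<Phi> :: "'w \<Rightarrow> (real^2) set"
    and N1 :: "'u measure" and \<Psi>1 :: "'u \<Rightarrow> (real^2) set" and H1 :: "'u \<Rightarrow> real^2 \<Rightarrow> real"
    and N2 :: "'v measure" and \<Psi>2 :: "'v \<Rightarrow> (real^2) set" and H2 :: "'v \<Rightarrow> real^2 \<Rightarrow> real"
  assumes "lam > 0" and "p_p > 0" and "p_g > 0" and "\<alpha> > 2"
    and "\<eta> = p_p / p_g" and "\<xi> > 0"
    and "homogeneous_poisson_process lam M \<Phi>"
  shows "(R > 0 \<and> conditioned_outside_ball M \<Phi> R N1 \<Psi>1 \<and> iid_exponential_marks N1 \<Psi>1 H1 \<longrightarrow>
           laplace_transform N1 (interference p_p \<alpha> \<Psi>1 H1) \<xi> =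
             exp (- 2 * pi * lam *
               (LBINT u=ereal R..\<infinity>.
                  p_p * \<xi> * u powr (1 - \<alpha>) / (1 + p_p * \<xi> * u powr (-\<alpha>))))) \<and>
         (conditioned_outside_ball M \<Phi> (norm U * \<eta> powr (1 / \<alpha>)) N2 \<Psi>2 \<and>
           iid_exponential_marks N2 \<Psi>2 H2 \<longrightarrow>
           laplace_transform N2 (interference p_p \<alpha> \<Psi>2 H2) \<xi> =
             exp (- 2 * pi * lam *
               (LBINT u=ereal (norm U * \<eta> powr (1 / \<alpha>))..\<infinity>.
                  p_p * \<xi> * u powr (1 - \<alpha>) / (1 + p_p * \<xi> * u powr (-\<alpha>)))))"
  using assms by (intro conjI impI; elim conjE; intro laplace_interference[OF assms(7)]; simp)

end
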